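(* Let $\mathcal H$ be a real Hilbert space, $C\subseteq\mathcal H$ nonempty, closed and convex, and $F:\mathcal H\to\mathcal H$. Assume that $SOL(C,F)\neq\emptyset$, that $F$ is monotone on $\mathcal H$, and that $F$ is Lipschitz continuous on $\mathcal H$ with some constant $L>0$. Let the perturbation vectors satisfy $\sum_{k=0}^\infty\|e_i^k\|<+\infty$ for $i=1,2$, and let $\{x^k\}_{k=0}^\infty$ and $\{y^k\}_{k=0}^\infty$ be any two sequences generated by the PC-algorithm I with outer perturbations (described in the context). For any integer $t>0$ put $$\Upsilon_t=\sum_{k=0}^t\rho_k\beta_k,\qquad \hat y_t=\frac1{\Upsilon_t}\sum_{k=0}^t\rho_k\beta_k(y^k-e_1^k),\qquad y_t=\frac1{\Upsilon_t}\sum_{k=0}^t\rho_k\beta_ky^k,$$ and, for $x\in C$, $M=M(x)=\sup_{k\in\mathbb N}\{\|x^{k+1}-x\|\}\,\sum_{k=0}^\infty\|e_2^k\|$. Then $\hat y_t\in C$ and $$\langle F(x),\hat y_t-x\rangle\le\frac1{2\gamma\Upsilon_t}\left(\|x-x^0\|^2+2M\right),\qquad\forall x\in C.$$ Further, $$\langle F(x),y_t-x\rangle\le\frac1{2\gamma\Upsilon_t}\left(\|x-x^0\|^2+2M\right)+\frac{\|F(x)\|}{\Upsilon_t}\sum_{k=0}^t\rho_k\beta_k\|e_1^k\|,\qquad\forall x\in C.$$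
   Context: The variational inequality problem is: find $x^*\in C$ with $\langle F(x^* ),x-x^*\rangle\ge 0$ for all $x\in C$; its solution set is $SOL(C,F)$. Monotone means $\langle F(x)-F(y),x-y\rangle\ge0$ for all $x,y\in\mathcal H$. $P_C$ denotes the metric projection onto $C$. $\mathbb N$ includes $0$. PC-algorithm I with outer perturbations: fix $\nu\in(0,1)$ and $\gamma\in(0,2)$. Choose $x^0\in\mathcal H$ arbitrarily. Given $x^k\in\mathcal H$ and perturbation vectors $e_1^k=e_1(x^k)$, $e_2^k=e_2(x^k)$ in $\mathcal H$, set $$y^k=P_C(x^k-\beta_kF(x^k))+e_1^k,$$ where $\beta_k>0$ is selected such that $$\beta_k\|F(x^k)-F(y^k-e_1^k)\|\le\nu\|x^k-y^k+e_1^k\|.$$ Define $$d(x^k,y^k)=(x^k-y^k+e_1^k)-\beta_k\big(F(x^k)-F(y^k-e_1^k)\big),\qquad \varphi(x^k,y^k)=\langle x^k-y^k+e_1^k,d(x^k,y^k)\rangle,$$ $$\rho_k=\frac{\varphi(x^k,y^k)}{\|d(x^k,y^k)\|^2},\qquad x^{k+1}=x^k-\gamma\rho_kd(x^k,y^k)+e_2^k.$$ It is understood that $d(x^k,y^k)\ne0$ for all $k$, so that $\rho_k$ is defined. *)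

theory Defs
  imports "HOL-Analysis.Analysis"
begin

(* A real Hilbert space is a type of sort {real_inner, complete_space}. *)

(* closest_point of HOL-Analysis requires a Heine-Borel space, which excludes infinite-dimensional
   Hilbert spaces. For C nonempty, closed and convex the nearest point exists and is unique, so
   the description is proper. *)
definition metric_projection :: "'a::metric_space set \<Rightarrow> 'a \<Rightarrow> 'a" where
  "metric_projection C z = (THE p. p \<in> C \<and> (\<forall>q\<in>C. dist z p \<le> dist z q))"

definition VI_solutions :: "'a::real_inner set \<Rightarrow> ('a \<Rightarrow> 'a) \<Rightarrow> 'a set" where
  "VI_solutions C F = {z \<in> C. \<forall>x\<in>C. inner (F z) (x - z) \<ge> 0}"

definition monotone_operator :: "('a::real_inner \<Rightarrow> 'a) \<Rightarrow> bool" where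
  "monotone_operator F \<longleftrightarrow> (\<forall>x y. inner (F x - F y) (x - y) \<ge> 0)"

definition pc_d ::
  "('a::real_inner \<Rightarrow> 'a) \<Rightarrow> (nat \<Rightarrow> real) \<Rightarrow> (nat \<Rightarrow> 'a) \<Rightarrow> (nat \<Rightarrow> 'a) \<Rightarrow> (nat \<Rightarrow> 'a) \<Rightarrow> nat \<Rightarrow> 'a"
  where "pc_d F \<beta> e1 x y k = (x k - y k + e1 k) - \<beta> k *\<^sub>R (F (x k) - F (y k - e1 k))"

definition pc_phi ::
  "('a::real_inner \<Rightarrow> 'a) \<Rightarrow> (nat \<Rightarrow> real) \<Rightarrow> (nat \<Rightarrow> 'a) \<Rightarrow> (nat \<Rightarrow> 'a) \<Rightarrow> (nat \<Rightarrow> 'a) \<Rightarrow> nat \<Rightarrow> real"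
  where "pc_phi F \<beta> e1 x y k = inner (x k - y k + e1 k) (pc_d F \<beta> e1 x y k)"

definition pc_rho ::
  "('a::real_inner \<Rightarrow> 'a) \<Rightarrow> (nat \<Rightarrow> real) \<Rightarrow> (nat \<Rightarrow> 'a) \<Rightarrow> (nat \<Rightarrow> 'a) \<Rightarrow> (nat \<Rightarrow> 'a) \<Rightarrow> nat \<Rightarrow> real"
  where "pc_rho F \<beta> e1 x y k = pc_phi F \<beta> e1 x y k / (norm (pc_d F \<beta> e1 x y k))\<^sup>2"

(* x and y are generated by the PC-algorithm I with outer perturbations. The starting point x 0
   is unconstrained. The perturbations may be arbitrary sequences; perturbations
   depending on the current iterate, e1 k = g1 (x k) and e2 k = g2 (x k), are a special case. *)
definition PC_algorithm_I ::
  "'a::real_inner set \<Rightarrow> ('a \<Rightarrow> 'a) \<Rightarrow> real \<Rightarrow> real \<Rightarrow> (nat \<Rightarrow> real) \<Rightarrow>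
    (nat \<Rightarrow> 'a) \<Rightarrow> (nat \<Rightarrow> 'a) \<Rightarrow> (nat \<Rightarrow> 'a) \<Rightarrow> (nat \<Rightarrow> 'a) \<Rightarrow> bool" where
  "PC_algorithm_I C F \<nu> \<gamma> \<beta> e1 e2 x y \<longleftrightarrow>
    (\<forall>k. y k = metric_projection C (x k - \<beta> k *\<^sub>R F (x k)) + e1 k \<and>
         \<beta> k > 0 \<and>
         \<beta> k * norm (F (x k) - F (y k - e1 k)) \<le> \<nu> * norm (x k - y k + e1 k) \<and>
         pc_d F \<beta> e1 x y k \<noteq> 0 \<and>
         x (Suc k) = x k - (\<gamma> * pc_rho F \<beta> e1 x y k) *\<^sub>R pc_d F \<beta> e1 x y k + e2 k)"

definition pc_Upsilon ::
  "('a::real_inner \<Rightarrow> 'a) \<Rightarrow> (nat \<Rightarrow> real) \<Rightarrow> (nat \<Rightarrow> 'a) \<Rightarrow> (nat \<Rightarrow> 'a) \<Rightarrow> (nat \<Rightarrow> 'a) \<Rightarrow> nat \<Rightarrow> real"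
  where "pc_Upsilon F \<beta> e1 x y t = (\<Sum>k=0..t. pc_rho F \<beta> e1 x y k * \<beta> k)"

definition pc_yhat ::
  "('a::real_inner \<Rightarrow> 'a) \<Rightarrow> (nat \<Rightarrow> real) \<Rightarrow> (nat \<Rightarrow> 'a) \<Rightarrow> (nat \<Rightarrow> 'a) \<Rightarrow> (nat \<Rightarrow> 'a) \<Rightarrow> nat \<Rightarrow> 'a"
  where "pc_yhat F \<beta> e1 x y t =
    (1 / pc_Upsilon F \<beta> e1 x y t) *\<^sub>R (\<Sum>k=0..t. (pc_rho F \<beta> e1 x y k * \<beta> k) *\<^sub>R (y k - e1 k))"

definition pc_yavg ::
  "('a::real_inner \<Rightarrow> 'a) \<Rightarrow> (nat \<Rightarrow> real) \<Rightarrow> (nat \<Rightarrow> 'a) \<Rightarrow> (nat \<Rightarrow> 'a) \<Rightarrow> (nat \<Rightarrow> 'a) \<Rightarrow> nat \<Rightarrow> 'a"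
  where "pc_yavg F \<beta> e1 x y t =
    (1 / pc_Upsilon F \<beta> e1 x y t) *\<^sub>R (\<Sum>k=0..t. (pc_rho F \<beta> e1 x y k * \<beta> k) *\<^sub>R y k)"

(* M(u), for a comparison point u in C. The real supremum is meaningful only for bounded iterates.
   They are bounded when x is generated by PC_algorithm_I with 0 < nu < 1 and 0 < gamma < 2, e2 is
   absolutely summable, C is nonempty, closed and convex, F is monotone and VI_solutions C F is
   nonempty, by the Fejer-type estimate for a solution of the variational inequality. *)
definition pc_M :: "(nat \<Rightarrow> 'a::real_inner) \<Rightarrow> (nat \<Rightarrow> 'a) \<Rightarrow> 'a \<Rightarrow> real" where
  "pc_M e2 x u = (SUP k. norm (x (Suc k) - u)) * (\<Sum>k. norm (e2 k))"

end

theory Submission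
  imports Defs
begin

text \<open>
  Put \<open>p\<^sub>k = y\<^sub>k - e1\<^sub>k\<close>, the unperturbed projection. Two things are needed: the averages of
  the \<open>p\<^sub>k\<close> are convex combinations, and every step must change the squared distance to a
  point \<open>u\<close> of \<open>C\<close> by an amount controlled by \<open>\<langle>F u, p\<^sub>k - u\<rangle>\<close>.

  The step size rule with \<open>\<nu> < 1\<close> makes \<open>\<phi>\<close> positive (\<open>correction_direction_positive\<close>), so all
  weights \<open>\<rho>\<^sub>k \<beta>\<^sub>k\<close> are positive and the first claim is convexity of \<open>C\<close>.

  The obtuse-angle property of the projection, combined with monotonicity, gives
  \<open>\<langle>d, x\<^sub>k - u\<rangle> \<ge> \<phi> + \<beta>\<^sub>k \<langle>F u, p\<^sub>k - u\<rangle>\<close>. Since \<open>\<rho>\<^sub>k \<parallel>d\<parallel>\<^sup>2 = \<phi>\<close>, expanding the square of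
  \<open>\<parallel>x\<^sub>k - \<gamma> \<rho>\<^sub>k d - u\<parallel>\<close> leaves the nonpositive term \<open>-\<gamma> (2 - \<gamma>) \<rho>\<^sub>k \<phi>\<close> and the term
  \<open>-2 \<gamma> \<rho>\<^sub>k \<beta>\<^sub>k \<langle>F u, p\<^sub>k - u\<rangle>\<close> (\<open>correction_step_estimate\<close>). Adding \<open>e2\<^sub>k\<close> costs at most
  \<open>2 \<parallel>e2\<^sub>k\<parallel> \<parallel>x\<^sub>k\<^sub>+\<^sub>1 - u\<parallel>\<close>. Summed over \<open>k\<close>, the squared distances telescope and the costs add up
  to at most \<open>2 M\<close>; dividing by \<open>2 \<gamma> \<Upsilon>\<close> gives the estimate for the averages of the \<open>p\<^sub>k\<close>, and
  the Cauchy-Schwarz inequality transfers it to the averages of the \<open>y\<^sub>k\<close>.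

  The bound by \<open>M\<close> requires its supremum to be taken over a bounded set. This is where a solution of
  the variational inequality enters: for such a \<open>u\<close> the term \<open>\<langle>F u, p\<^sub>k - u\<rangle>\<close> is nonnegative, so
  the distance to it grows by at most \<open>\<parallel>e2\<^sub>k\<parallel>\<close> in each step, a summable amount.
\<close>

section \<open>Metric projection in a Hilbert space\<close>

text \<open>
  By the parallelogram law, two points of a convex set that nearly minimize the distance to \<open>z\<close> are
  close to each other, because their midpoint cannot beat the lower bound \<open>\<delta>\<close>.
\<close>

lemma near_minimizers_close:
  fixes C :: "'a::real_inner set"
  assumes "convex C" "a \<in> C" "b \<in> C" "0 \<le> \<delta>" and lower: "\<forall>q\<in>C. \<delta> \<le> dist z q"
  shows "(dist a b)\<^sup>2 \<le> 2 * ((dist z a)\<^sup>2 - \<delta>\<^sup>2) + 2 * ((dist z b)\<^sup>2 - \<delta>\<^sup>2)"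
proof -
  let ?m = "(1/2) *\<^sub>R a + (1/2) *\<^sub>R b"
  have "?m \<in> C"
    using assms(1-3) by (intro convexD) auto
  then have "\<delta>\<^sup>2 \<le> (norm (z - ?m))\<^sup>2"
    using lower \<open>0 \<le> \<delta>\<close> by (metis dist_norm power_mono)
  moreover have "(norm (a - b))\<^sup>2 + 4 * (norm (z - ?m))\<^sup>2 = 2 * (norm (z - a))\<^sup>2 + 2 * (norm (z - b))\<^sup>2"
    by (simp add: power2_norm_eq_inner inner_diff inner_add inner_commute algebra_simps)
  ultimately show ?thesis
    by (simp add: dist_norm)
qed

text \<open>
  Completeness replaces compactness: a minimizing sequence is Cauchy by \<open>near_minimizers_close\<close>,
  and its limit attains the distance.
\<close>

lemma nearest_point_exists:
  fixes C :: "'a::{real_inner, complete_space} set"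
  assumes "C \<noteq> {}" "closed C" "convex C"
  obtains p where "p \<in> C" "\<forall>q\<in>C. dist z p \<le> dist z q"
proof -
  define \<delta> where "\<delta> = infdist z C"
  have d0: "0 \<le> \<delta>" and lower: "\<forall>q\<in>C. \<delta> \<le> dist z q"
    by (simp_all add: \<delta>_def infdist_nonneg infdist_le)
  have "\<exists>q\<in>C. (dist z q)\<^sup>2 < \<delta>\<^sup>2 + inverse (real (Suc n))" for n
  proof -
    have "\<delta> < sqrt (\<delta>\<^sup>2 + inverse (real (Suc n)))"
      by (rule real_less_rsqrt) simp
    then obtain q where "q \<in> C" "dist z q < sqrt (\<delta>\<^sup>2 + inverse (real (Suc n)))"
      unfolding \<delta>_def infdist_notempty[OF \<open>C \<noteq> {}\<close>]
      using cInf_lessD[of "dist z ` C"] \<open>C \<noteq> {}\<close> by auto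
    then have "(dist z q)\<^sup>2 < (sqrt (\<delta>\<^sup>2 + inverse (real (Suc n))))\<^sup>2"
      by (intro power_strict_mono) auto
    with \<open>q \<in> C\<close> show ?thesis
      by (intro bexI[of _ q]) (simp_all add: add_nonneg_nonneg)
  qed
  then obtain q where qC: "\<And>n. q n \<in> C"
    and q: "\<And>n. (dist z (q n))\<^sup>2 < \<delta>\<^sup>2 + inverse (real (Suc n))"
    by metis
  have "Cauchy q"
  proof (rule metric_CauchyI)
    fix e :: real assume "e > 0"
    then obtain N where N: "inverse (real (Suc N)) < e\<^sup>2 / 4"
      using reals_Archimedean[of "e\<^sup>2 / 4"] by auto
    have "dist (q m) (q n) < e" if "m \<ge> N" "n \<ge> N" for m n
    proof -
      have excess: "(dist z (q j))\<^sup>2 - \<delta>\<^sup>2 < e\<^sup>2 / 4" if "j \<ge> N" for j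
      proof -
        have "inverse (real (Suc j)) \<le> inverse (real (Suc N))"
          using that by (intro le_imp_inverse_le) auto
        then have "\<delta>\<^sup>2 + inverse (real (Suc j)) < \<delta>\<^sup>2 + e\<^sup>2 / 4"
          using N by (intro add_strict_left_mono) (rule le_less_trans)
        from less_trans[OF q this] show ?thesis
          by (simp add: algebra_simps)
      qed
      have "(dist (q m) (q n))\<^sup>2 < e\<^sup>2"
      proof -
        have "(dist (q m) (q n))\<^sup>2
            \<le> 2 * ((dist z (q m))\<^sup>2 - \<delta>\<^sup>2) + 2 * ((dist z (q n))\<^sup>2 - \<delta>\<^sup>2)"
          by (rule near_minimizers_close[OF \<open>convex C\<close> qC qC d0 lower])
        also have "\<dots> < 2 * (e\<^sup>2 / 4) + 2 * (e\<^sup>2 / 4)"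
          by (intro add_strict_mono mult_strict_left_mono excess that) simp_all
        finally show ?thesis
          by simp
      qed
      then show ?thesis
        using \<open>e > 0\<close> power_less_imp_less_base by (metis less_imp_le)
    qed
    then show "\<exists>N. \<forall>m\<ge>N. \<forall>n\<ge>N. dist (q m) (q n) < e"
      by blast
  qed
  then obtain p where p: "q \<longlonglongrightarrow> p"
    using Cauchy_convergent convergent_def by blast
  have "p \<in> C"
    using closed_sequentially[OF \<open>closed C\<close> qC p] .
  moreover have "dist z p \<le> dist z c" if "c \<in> C" for c
  proof -
    have "(\<lambda>n. (dist z (q n))\<^sup>2) \<longlonglongrightarrow> (dist z p)\<^sup>2"
      by (intro tendsto_intros p)
    moreover have "(\<lambda>n. \<delta>\<^sup>2 + inverse (real (Suc n))) \<longlonglongrightarrow> \<delta>\<^sup>2 + 0"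
      by (intro tendsto_add tendsto_const LIMSEQ_inverse_real_of_nat)
    ultimately have "(dist z p)\<^sup>2 \<le> \<delta>\<^sup>2 + 0"
      by (rule LIMSEQ_le) (use q less_imp_le in blast)
    then have "dist z p \<le> \<delta>"
      using power2_le_imp_le[OF _ d0] by simp
    then show ?thesis
      using bspec[OF lower that] by linarith
  qed
  ultimately show ?thesis
    using that by blast
qed

lemma metric_projection_nearest:
  fixes C :: "'a::{real_inner, complete_space} set"
  assumes "C \<noteq> {}" "closed C" "convex C"
  shows "metric_projection C z \<in> C \<and> (\<forall>q\<in>C. dist z (metric_projection C z) \<le> dist z q)"
proof -
  obtain p where p: "p \<in> C" "\<forall>q\<in>C. dist z p \<le> dist z q"
    using nearest_point_exists[OF assms] by blast
  show ?thesis
    unfolding metric_projection_def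
  proof (rule theI)
    show "p \<in> C \<and> (\<forall>q\<in>C. dist z p \<le> dist z q)"
      using p by blast
    show "p' = p" if "p' \<in> C \<and> (\<forall>q\<in>C. dist z p' \<le> dist z q)" for p'
      using any_closest_point_unique[OF assms(3,2)] p that by blast
  qed
qed

lemma metric_projection_obtuse:
  fixes C :: "'a::{real_inner, complete_space} set"
  assumes "closed C" "convex C" "u \<in> C"
  shows "inner (z - metric_projection C z) (u - metric_projection C z) \<le> 0"
proof -
  have "C \<noteq> {}"
    using assms(3) by blast
  with metric_projection_nearest[OF _ assms(1,2)] show ?thesis
    using any_closest_point_dot[OF assms(2,1) _ assms(3)] by blast
qed

section \<open>One step of the algorithm\<close>

text \<open>
  In the algorithm \<open>w = x - p\<close>, \<open>g = \<beta> (F x - F p)\<close> and \<open>d = w - g\<close>. Cauchy-Schwarz bounds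
  \<open>\<langle>w, d\<rangle>\<close> from below by \<open>(1 - \<nu>) \<parallel>w\<parallel>\<^sup>2\<close>, and \<open>w\<close> cannot vanish, since then \<open>g\<close> and hence \<open>d\<close>
  would vanish as well.
\<close>

lemma correction_direction_positive:
  fixes w g :: "'a::real_inner"
  assumes "norm g \<le> \<nu> * norm w" "\<nu> < 1" "w - g \<noteq> 0"
  shows "inner w (w - g) > 0"
proof -
  have "w \<noteq> 0"
    using assms(1,3) by auto
  have "inner w g \<le> norm w * norm g"
    by (rule norm_cauchy_schwarz)
  also have "\<dots> \<le> norm w * (\<nu> * norm w)"
    using assms(1) by (intro mult_left_mono) auto
  also have "\<dots> < norm w * (1 * norm w)"
    using \<open>w \<noteq> 0\<close> \<open>\<nu> < 1\<close> by (intro mult_strict_left_mono mult_strict_right_mono) auto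
  finally show ?thesis
    by (simp add: inner_diff_right dot_square_norm power2_eq_square)
qed

text \<open>
  The assumption on \<open>p\<close> is the obtuse-angle property of the projection of \<open>x - b F x\<close>. It says
  \<open>\<langle>d, p - u\<rangle> \<ge> b \<langle>F p, p - u\<rangle>\<close>, and monotonicity replaces \<open>F p\<close> by \<open>F u\<close>.
\<close>

lemma correction_step_estimate:
  fixes F :: "'a::real_inner \<Rightarrow> 'a"
  assumes mono: "monotone_operator F"
    and obtuse: "inner (x - b *\<^sub>R F x - p) (u - p) \<le> 0"
    and "b \<ge> 0" "0 \<le> \<gamma>" "\<gamma> \<le> 2"
    and d: "d = (x - p) - b *\<^sub>R (F x - F p)"
    and "inner (x - p) d \<ge> 0" "d \<noteq> 0"
    and r: "r = inner (x - p) d / (norm d)\<^sup>2"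
  shows "(norm (x - (\<gamma> * r) *\<^sub>R d - u))\<^sup>2
    \<le> (norm (x - u))\<^sup>2 - 2 * \<gamma> * (r * b * inner (F u) (p - u))"
proof -
  define \<phi> where "\<phi> = inner (x - p) d"
  have r0: "r \<ge> 0" and rd: "r * (norm d)\<^sup>2 = \<phi>" and \<phi>0: "\<phi> \<ge> 0"
    using assms by (simp_all add: \<phi>_def)
  have "inner (F u) (p - u) \<le> inner (F p) (p - u)"
    using mono unfolding monotone_operator_def by (metis diff_ge_0_iff_ge inner_diff_left)
  then have "b * inner (F u) (p - u) \<le> b * inner (F p) (p - u)"
    using \<open>b \<ge> 0\<close> by (rule mult_left_mono)
  also have "\<dots> \<le> inner d (p - u)"
    using obtuse by (simp add: d inner_diff algebra_simps)
  finally have "\<phi> + b * inner (F u) (p - u) \<le> inner d (x - u)"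
    by (simp add: \<phi>_def inner_diff inner_commute algebra_simps)
  then have "2 * \<gamma> * r * (\<phi> + b * inner (F u) (p - u)) \<le> 2 * \<gamma> * r * inner d (x - u)"
    using r0 \<open>0 \<le> \<gamma>\<close> by (intro mult_left_mono) auto
  moreover have "(norm (x - (\<gamma> * r) *\<^sub>R d - u))\<^sup>2
      = (norm (x - u))\<^sup>2 - 2 * \<gamma> * r * inner d (x - u) + \<gamma>\<^sup>2 * r * (r * (norm d)\<^sup>2)"
    by (simp add: power2_norm_eq_inner inner_diff inner_commute algebra_simps power2_eq_square[of \<gamma>])
  moreover have "0 \<le> \<gamma> * (2 - \<gamma>) * (r * \<phi>)"
    using r0 \<phi>0 \<open>0 \<le> \<gamma>\<close> \<open>\<gamma> \<le> 2\<close> by simp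
  ultimately show ?thesis
    unfolding rd by (simp add: algebra_simps power2_eq_square)
qed

section \<open>The perturbed iteration\<close>

lemma PC_algorithm_I_unperturbed_in_C:
  fixes C :: "'a::{real_inner, complete_space} set"
  assumes "C \<noteq> {}" "closed C" "convex C" "PC_algorithm_I C F \<nu> \<gamma> \<beta> e1 e2 x y"
  shows "y k - e1 k \<in> C"
  using assms(4) metric_projection_nearest[OF assms(1-3)] unfolding PC_algorithm_I_def
  by (metis add_diff_cancel_right')

lemma PC_algorithm_I_rho_positive:
  assumes "PC_algorithm_I C F \<nu> \<gamma> \<beta> e1 e2 x y" "\<nu> < 1"
  shows "pc_rho F \<beta> e1 x y k > 0"
proof -
  define g where "g = \<beta> k *\<^sub>R (F (x k) - F (y k - e1 k))"
  have d: "pc_d F \<beta> e1 x y k = (x k - y k + e1 k) - g"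
    by (simp add: pc_d_def g_def)
  have "norm g \<le> \<nu> * norm (x k - y k + e1 k)" "(x k - y k + e1 k) - g \<noteq> 0"
  proof -
    have "0 < \<beta> k"
      "\<beta> k * norm (F (x k) - F (y k - e1 k)) \<le> \<nu> * norm (x k - y k + e1 k)"
      "pc_d F \<beta> e1 x y k \<noteq> 0"
      using assms(1) unfolding PC_algorithm_I_def by blast+
    then show "norm g \<le> \<nu> * norm (x k - y k + e1 k)" "(x k - y k + e1 k) - g \<noteq> 0"
      unfolding d[symmetric] by (simp_all add: g_def)
  qed
  then show ?thesis
    using correction_direction_positive[OF _ assms(2), of g "x k - y k + e1 k"]
    unfolding pc_rho_def pc_phi_def d by (intro divide_pos_pos) auto
qed

lemma PC_algorithm_I_step:
  fixes C :: "'a::{real_inner, complete_space} set"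
  assumes "closed C" "convex C" "monotone_operator F" "\<nu> < 1" "0 < \<gamma>" "\<gamma> < 2"
    and alg: "PC_algorithm_I C F \<nu> \<gamma> \<beta> e1 e2 x y"
    and "u \<in> C"
  shows "(norm (x (Suc k) - e2 k - u))\<^sup>2 \<le> (norm (x k - u))\<^sup>2
    - 2 * \<gamma> * (pc_rho F \<beta> e1 x y k * \<beta> k * inner (F u) (y k - e1 k - u))"
proof -
  define p where "p = y k - e1 k"
  define d where "d = pc_d F \<beta> e1 x y k"
  define r where "r = pc_rho F \<beta> e1 x y k"
  have xp: "x k - p = x k - y k + e1 k"
    by (simp add: p_def)
  have p: "p = metric_projection C (x k - \<beta> k *\<^sub>R F (x k))"
    and "\<beta> k > 0" and "d \<noteq> 0"
    and step: "x (Suc k) - e2 k = x k - (\<gamma> * r) *\<^sub>R d"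
    using alg unfolding PC_algorithm_I_def by (simp_all add: p_def d_def r_def)
  have d: "d = (x k - p) - \<beta> k *\<^sub>R (F (x k) - F p)"
    by (simp add: d_def pc_d_def p_def)
  have r: "r = inner (x k - p) d / (norm d)\<^sup>2"
    unfolding xp by (simp add: r_def d_def pc_rho_def pc_phi_def)
  have "r > 0"
    unfolding r_def by (rule PC_algorithm_I_rho_positive[OF alg \<open>\<nu> < 1\<close>])
  then have "inner (x k - p) d \<ge> 0"
    unfolding r by (simp add: zero_less_divide_iff)
  then show ?thesis
    unfolding step r_def[symmetric] p_def[symmetric]
    using correction_step_estimate[OF \<open>monotone_operator F\<close> _ _ _ _ d _ \<open>d \<noteq> 0\<close> r]
      metric_projection_obtuse[OF assms(1,2) \<open>u \<in> C\<close>, of "x k - \<beta> k *\<^sub>R F (x k)", folded p]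
      \<open>\<beta> k > 0\<close> \<open>0 < \<gamma>\<close> \<open>\<gamma> < 2\<close> by auto
qed

text \<open>
  Quasi-Fejer monotonicity with respect to a solution \<open>s\<close>: without the perturbation \<open>e2\<^sub>k\<close> the
  distance to \<open>s\<close> does not increase.
\<close>

lemma PC_algorithm_I_bounded:
  fixes C :: "'a::{real_inner, complete_space} set"
  assumes "C \<noteq> {}" "closed C" "convex C" "monotone_operator F" "\<nu> < 1" "0 < \<gamma>" "\<gamma> < 2"
    and alg: "PC_algorithm_I C F \<nu> \<gamma> \<beta> e1 e2 x y"
    and s: "s \<in> VI_solutions C F"
    and summ: "summable (\<lambda>k. norm (e2 k))"
  shows "norm (x k - s) \<le> norm (x 0 - s) + (\<Sum>k. norm (e2 k))"
proof -
  have "s \<in> C" and vi: "\<And>v. v \<in> C \<Longrightarrow> inner (F s) (v - s) \<ge> 0"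
    using s by (auto simp: VI_solutions_def)
  have step: "norm (x (Suc k) - s) \<le> norm (x k - s) + norm (e2 k)" for k
  proof -
    have "y k - e1 k \<in> C"
      by (rule PC_algorithm_I_unperturbed_in_C[OF assms(1-3) alg])
    moreover have "\<beta> k > 0"
      using alg by (simp add: PC_algorithm_I_def)
    ultimately have "0 \<le> 2 * \<gamma> * (pc_rho F \<beta> e1 x y k * \<beta> k * inner (F s) (y k - e1 k - s))"
      using vi PC_algorithm_I_rho_positive[OF alg \<open>\<nu> < 1\<close>, of k] \<open>0 < \<gamma>\<close> by simp
    then have "(norm (x (Suc k) - e2 k - s))\<^sup>2 \<le> (norm (x k - s))\<^sup>2"
      using PC_algorithm_I_step[OF assms(2-7) alg \<open>s \<in> C\<close>, of k] by linarith
    then have "norm (x (Suc k) - e2 k - s) \<le> norm (x k - s)"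
      by (rule power2_le_imp_le) simp
    then show ?thesis
      using norm_triangle_ineq[of "x (Suc k) - e2 k - s" "e2 k"] by (simp add: algebra_simps)
  qed
  have "norm (x k - s) \<le> norm (x 0 - s) + (\<Sum>j<k. norm (e2 j))"
  proof (induction k)
    case (Suc k)
    then show ?case
      using step[of k] by simp
  qed simp
  also have "\<dots> \<le> norm (x 0 - s) + (\<Sum>k. norm (e2 k))"
    using sum_le_suminf[OF summ] by simp
  finally show ?thesis .
qed

text \<open>
  The telescoped estimate. Writing \<open>z = x\<^sub>k\<^sub>+\<^sub>1 - e2\<^sub>k\<close>, the perturbation is charged against the
  next iterate instead of \<open>z\<close>, by
  \<open>\<parallel>x\<^sub>k\<^sub>+\<^sub>1 - u\<parallel>\<^sup>2 = \<parallel>z - u\<parallel>\<^sup>2 + 2 \<langle>e2\<^sub>k, x\<^sub>k\<^sub>+\<^sub>1 - u\<rangle> - \<parallel>e2\<^sub>k\<parallel>\<^sup>2\<close>; that is why \<open>M\<close> involves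
  \<open>x\<^sub>k\<^sub>+\<^sub>1\<close>.
\<close>

lemma PC_algorithm_I_sum_estimate:
  fixes C :: "'a::{real_inner, complete_space} set"
  assumes "closed C" "convex C" "monotone_operator F" "\<nu> < 1" "0 < \<gamma>" "\<gamma> < 2"
    and alg: "PC_algorithm_I C F \<nu> \<gamma> \<beta> e1 e2 x y"
    and u: "u \<in> C"
    and bdd: "bdd_above (range (\<lambda>k. norm (x (Suc k) - u)))"
    and summ: "summable (\<lambda>k. norm (e2 k))"
  shows "2 * \<gamma> * (\<Sum>k=0..t. pc_rho F \<beta> e1 x y k * \<beta> k * inner (F u) (y k - e1 k - u))
    \<le> (norm (u - x 0))\<^sup>2 + 2 * pc_M e2 x u"
proof -
  define c where "c k = pc_rho F \<beta> e1 x y k * \<beta> k * inner (F u) (y k - e1 k - u)" for k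
  define S where "S = (SUP k. norm (x (Suc k) - u))"
  have S: "norm (x (Suc k) - u) \<le> S" for k
    unfolding S_def by (rule cSUP_upper[OF _ bdd]) simp
  then have S0: "S \<ge> 0"
    using norm_ge_zero order_trans by blast
  have step: "2 * \<gamma> * c k \<le> (norm (x k - u))\<^sup>2 - (norm (x (Suc k) - u))\<^sup>2 + 2 * (S * norm (e2 k))"
    for k
  proof -
    have "(norm (x (Suc k) - u))\<^sup>2 = (norm (x (Suc k) - e2 k - u))\<^sup>2
        + 2 * inner (e2 k) (x (Suc k) - u) - (norm (e2 k))\<^sup>2"
      by (simp add: power2_norm_eq_inner inner_diff inner_commute algebra_simps)
    moreover have "inner (e2 k) (x (Suc k) - u) \<le> norm (e2 k) * norm (x (Suc k) - u)"
      by (rule norm_cauchy_schwarz)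
    moreover have "norm (e2 k) * norm (x (Suc k) - u) \<le> S * norm (e2 k)"
      using mult_left_mono[OF S norm_ge_zero] by (simp add: mult.commute)
    moreover have "(norm (x (Suc k) - e2 k - u))\<^sup>2 \<le> (norm (x k - u))\<^sup>2 - 2 * \<gamma> * c k"
      unfolding c_def by (rule PC_algorithm_I_step[OF assms(1-6) alg u])
    ultimately show ?thesis
      using zero_le_power2[of "norm (e2 k)"] by linarith
  qed
  have "2 * \<gamma> * sum c {..<n} \<le> (norm (x 0 - u))\<^sup>2 - (norm (x n - u))\<^sup>2 + 2 * (S * (\<Sum>k<n. norm (e2 k)))"
    for n
  proof (induction n)
    case (Suc n)
    then show ?case
      using step[of n] by (simp add: algebra_simps)
  qed simp
  from this[of "Suc t"]
  have "2 * \<gamma> * sum c {0..t} \<le> (norm (x 0 - u))\<^sup>2 + 2 * (S * (\<Sum>k<Suc t. norm (e2 k)))"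
    unfolding atLeast0AtMost lessThan_Suc_atMost
    using zero_le_power2[of "norm (x (Suc t) - u)"] by linarith
  also have "S * (\<Sum>k<Suc t. norm (e2 k)) \<le> S * (\<Sum>k. norm (e2 k))"
    using S0 by (intro mult_left_mono sum_le_suminf summ) auto
  finally show ?thesis
    by (simp add: c_def pc_M_def S_def norm_minus_commute)
qed

section \<open>Ergodic rate of convergence\<close>

theorem theorem3p5:
  fixes C :: "'a::{real_inner, complete_space} set"
    and F :: "'a \<Rightarrow> 'a"
    and L \<nu> \<gamma> :: real
    and \<beta> :: "nat \<Rightarrow> real"
    and e1 e2 x y :: "nat \<Rightarrow> 'a"
    and t :: nat
  assumes "C \<noteq> {}" and "closed C" and "convex C"
    and "VI_solutions C F \<noteq> {}"
    and "monotone_operator F"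
    and "L > 0" and "L-lipschitz_on UNIV F"
    and "0 < \<nu>" and "\<nu> < 1" and "0 < \<gamma>" and "\<gamma> < 2"
    and "summable (\<lambda>k. norm (e1 k))" and "summable (\<lambda>k. norm (e2 k))"
    and "PC_algorithm_I C F \<nu> \<gamma> \<beta> e1 e2 x y"
    and "t > 0"
  shows "pc_yhat F \<beta> e1 x y t \<in> C \<and>
    (\<forall>u\<in>C. inner (F u) (pc_yhat F \<beta> e1 x y t - u)
       \<le> 1 / (2 * \<gamma> * pc_Upsilon F \<beta> e1 x y t) * ((norm (u - x 0))\<^sup>2 + 2 * pc_M e2 x u)) \<and>
    (\<forall>u\<in>C. inner (F u) (pc_yavg F \<beta> e1 x y t - u)
       \<le> 1 / (2 * \<gamma> * pc_Upsilon F \<beta> e1 x y t) * ((norm (u - x 0))\<^sup>2 + 2 * pc_M e2 x u)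
         + norm (F u) / pc_Upsilon F \<beta> e1 x y t
           * (\<Sum>k=0..t. pc_rho F \<beta> e1 x y k * \<beta> k * norm (e1 k)))"
proof -
  note alg = \<open>PC_algorithm_I C F \<nu> \<gamma> \<beta> e1 e2 x y\<close>
  note summ = \<open>summable (\<lambda>k. norm (e2 k))\<close>
  define a where "a k = pc_rho F \<beta> e1 x y k * \<beta> k" for k
  define U where "U = pc_Upsilon F \<beta> e1 x y t"
  have a0: "a k > 0" for k
    using alg PC_algorithm_I_rho_positive[OF alg \<open>\<nu> < 1\<close>, of k] unfolding a_def PC_algorithm_I_def
    by simp
  have U: "U = (\<Sum>k=0..t. a k)"
    by (simp add: U_def pc_Upsilon_def a_def)
  have U0: "U > 0"
    unfolding U using a0 by (intro sum_pos) auto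
  have yhat: "pc_yhat F \<beta> e1 x y t = (1 / U) *\<^sub>R (\<Sum>k=0..t. a k *\<^sub>R (y k - e1 k))"
    by (simp add: pc_yhat_def U_def a_def)
  have yavg: "pc_yavg F \<beta> e1 x y t = pc_yhat F \<beta> e1 x y t + (1 / U) *\<^sub>R (\<Sum>k=0..t. a k *\<^sub>R e1 k)"
    by (simp add: pc_yavg_def yhat U_def a_def scaleR_diff_right sum_subtractf)
  have pC: "y k - e1 k \<in> C" for k
    by (rule PC_algorithm_I_unperturbed_in_C[OF assms(1-3) alg])
  have in_C: "pc_yhat F \<beta> e1 x y t \<in> C"
  proof -
    have "(\<Sum>k=0..t. (a k / U) *\<^sub>R (y k - e1 k)) \<in> C"
      using U0 a0 pC
      by (intro convex_sum \<open>convex C\<close>) (auto simp: sum_divide_distrib[symmetric] U[symmetric] less_imp_le)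
    then show ?thesis
      by (simp add: yhat scaleR_sum_right)
  qed
  have hat: "inner (F u) (pc_yhat F \<beta> e1 x y t - u)
      \<le> 1 / (2 * \<gamma> * U) * ((norm (u - x 0))\<^sup>2 + 2 * pc_M e2 x u)" if u: "u \<in> C" for u
  proof -
    obtain s where s: "s \<in> VI_solutions C F"
      using \<open>VI_solutions C F \<noteq> {}\<close> by blast
    \<comment> \<open>The iterates stay near the solution \<open>s\<close>, hence at bounded distance from every other \<open>u\<close>.\<close>
    have bdd: "bdd_above (range (\<lambda>k. norm (x (Suc k) - u)))"
    proof (rule bdd_aboveI2)
      fix k
      have "norm (x (Suc k) - u) \<le> norm (x (Suc k) - s) + norm (s - u)"
        using norm_triangle_ineq[of "x (Suc k) - s" "s - u"] by simp
      then show "norm (x (Suc k) - u) \<le> norm (x 0 - s) + (\<Sum>k. norm (e2 k)) + norm (s - u)"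
        using PC_algorithm_I_bounded[OF assms(1-3,5,9-11) alg s summ, of "Suc k"] by linarith
    qed
    have "U * inner (F u) (pc_yhat F \<beta> e1 x y t - u)
        = inner (F u) ((\<Sum>k=0..t. a k *\<^sub>R (y k - e1 k)) - U *\<^sub>R u)"
      using U0 by (simp add: yhat inner_diff_right right_diff_distrib)
    also have "\<dots> = (\<Sum>k=0..t. a k * inner (F u) (y k - e1 k - u))"
      by (simp add: U scaleR_sum_left sum_subtractf[symmetric] inner_sum_right
          flip: scaleR_diff_right)
    finally have "2 * \<gamma> * (U * inner (F u) (pc_yhat F \<beta> e1 x y t - u))
        \<le> (norm (u - x 0))\<^sup>2 + 2 * pc_M e2 x u"
      using PC_algorithm_I_sum_estimate[OF assms(2,3,5,9-11) alg u bdd summ, of t]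
      by (simp add: a_def)
    then have "inner (F u) (pc_yhat F \<beta> e1 x y t - u) * (2 * \<gamma> * U)
        \<le> (norm (u - x 0))\<^sup>2 + 2 * pc_M e2 x u"
      by (simp only: mult_ac)
    moreover have "2 * \<gamma> * U > 0"
      using U0 \<open>0 < \<gamma>\<close> by simp
    ultimately show ?thesis
      by (simp add: pos_le_divide_eq)
  qed
  have avg: "inner (F u) (pc_yavg F \<beta> e1 x y t - u)
      \<le> 1 / (2 * \<gamma> * U) * ((norm (u - x 0))\<^sup>2 + 2 * pc_M e2 x u)
        + norm (F u) / U * (\<Sum>k=0..t. a k * norm (e1 k))" if u: "u \<in> C" for u
  proof -
    have "inner (F u) (\<Sum>k=0..t. a k *\<^sub>R e1 k) \<le> norm (F u) * norm (\<Sum>k=0..t. a k *\<^sub>R e1 k)"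
      by (rule norm_cauchy_schwarz)
    also have "\<dots> \<le> norm (F u) * (\<Sum>k=0..t. a k * norm (e1 k))"
      using a0 by (intro mult_left_mono sum_norm_le) (auto simp: less_imp_le)
    finally have "1 / U * inner (F u) (\<Sum>k=0..t. a k *\<^sub>R e1 k)
        \<le> 1 / U * (norm (F u) * (\<Sum>k=0..t. a k * norm (e1 k)))"
      using U0 by (intro mult_left_mono) auto
    moreover have "inner (F u) (pc_yavg F \<beta> e1 x y t - u)
        = inner (F u) (pc_yhat F \<beta> e1 x y t - u) + 1 / U * inner (F u) (\<Sum>k=0..t. a k *\<^sub>R e1 k)"
      by (simp add: yavg inner_diff_right inner_add_right)
    ultimately show ?thesis
      using hat[OF u] by simp
  qed
  show ?thesis
    using in_C hat avg unfolding U_def a_def by blast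
qed

end
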